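(* If a finite connected undirected graph $G$ has no stubborn edge, then there is a 2-edge-colouring $c:E(G)\to\{1,2\}$ under which $G$ is properly connected.
   Context: A walk is a sequence of vertices with consecutive vertices adjacent (vertices and edges may repeat); its length is its number of edges; it is closed if it starts and ends at the same vertex. An edge is stubborn if it belongs to every closed walk of odd length in $G$. A walk in an edge-coloured graph is properly coloured if no two consecutive edges of it have the same colour; the coloured graph is properly connected if every two vertices are joined by a properly coloured walk. *)

theory Defs
  imports Main
begin

text \<open>Graphs are simple: an edge is a two-element set of vertices.\<close>

definition simple_graph :: "'a set \<Rightarrow> 'a set set \<Rightarrow> bool" where
  "simple_graph V E \<longleftrightarrow> (\<forall>e\<in>E. e \<subseteq> V \<and> card e = 2)"

definition walk :: "'a set \<Rightarrow> 'a set set \<Rightarrow> 'a list \<Rightarrow> bool" where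
  "walk V E p \<longleftrightarrow> p \<noteq> [] \<and> set p \<subseteq> V \<and> successively (\<lambda>u v. {u, v} \<in> E) p"

fun walk_edges :: "'a list \<Rightarrow> 'a set list" where
  "walk_edges (u # v # p) = {u, v} # walk_edges (v # p)"
| "walk_edges _ = []"

definition walk_length :: "'a list \<Rightarrow> nat" where
  "walk_length p = length (walk_edges p)"

definition closed_walk :: "'a set \<Rightarrow> 'a set set \<Rightarrow> 'a list \<Rightarrow> bool" where
  "closed_walk V E p \<longleftrightarrow> walk V E p \<and> hd p = last p"

definition joins :: "'a list \<Rightarrow> 'a \<Rightarrow> 'a \<Rightarrow> bool" where
  "joins p u v \<longleftrightarrow> hd p = u \<and> last p = v"

definition connected_graph :: "'a set \<Rightarrow> 'a set set \<Rightarrow> bool" where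
  "connected_graph V E \<longleftrightarrow> (\<forall>u\<in>V. \<forall>v\<in>V. \<exists>p. walk V E p \<and> joins p u v)"

text \<open>In a bipartite graph there is no odd closed walk, so every edge is (vacuously) stubborn.\<close>

definition stubborn :: "'a set \<Rightarrow> 'a set set \<Rightarrow> 'a set \<Rightarrow> bool" where
  "stubborn V E e \<longleftrightarrow> e \<in> E \<and>
     (\<forall>p. closed_walk V E p \<and> odd (walk_length p) \<longrightarrow> e \<in> set (walk_edges p))"

definition properly_coloured :: "('a set \<Rightarrow> nat) \<Rightarrow> 'a list \<Rightarrow> bool" where
  "properly_coloured c p \<longleftrightarrow> successively (\<lambda>e f. c e \<noteq> c f) (walk_edges p)"

definition properly_connected :: "'a set \<Rightarrow> 'a set set \<Rightarrow> ('a set \<Rightarrow> nat) \<Rightarrow> bool" where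
  "properly_connected V E c \<longleftrightarrow>
     (\<forall>u\<in>V. \<forall>v\<in>V. \<exists>p. walk V E p \<and> joins p u v \<and> properly_coloured c p)"

end

theory Submission
  imports Defs
begin

text \<open>
  Pass to the bipartite double cover on \<open>V \<times> bool\<close>: an edge \<open>{x, y}\<close> of colour 1 gives the arcs from
  \<open>(x, False)\<close> to \<open>(y, True)\<close> and from \<open>(y, False)\<close> to \<open>(x, True)\<close>, an edge of colour 2 the arcs in the
  opposite directions. Properly coloured walks are the projections of directed walks, so a colouring
  with a strongly connected double cover is wanted. As in Robbins' theorem, one starts with all
  arcs in both directions, which is strongly connected because the graph is connected and not
  bipartite, and decides on the edges one at a time. If both choices for an edge \<open>e\<close> destroyed strong
  connectivity, uncrossing the two sets without outgoing arcs would show that the two lifts of \<open>e\<close>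
  contain a cut of the double cover separating \<open>(z, False)\<close> from \<open>(z, True)\<close> for an end \<open>z\<close> of \<open>e\<close>.
  That is impossible if both ends of \<open>e\<close> lie on odd closed walks avoiding \<open>e\<close>. A smallest
  connected part of the graph without stubborn edges has this property for all its edges, since otherwise
  a bipartite piece hanging at a bridge could be cut off. The remaining vertices are hung
  onto this part as trees, with colours alternating along the branches.
\<close>

section \<open>Cuts in a graph and in its double cover\<close>

definition two_colourable :: "'a set set \<Rightarrow> bool" where
  "two_colourable E \<longleftrightarrow> (\<exists>A. \<forall>x y. {x, y} \<in> E \<longrightarrow> (x \<in> A) \<noteq> (y \<in> A))"

text \<open>Connectivity in terms of cuts, so that it applies directly to sets built from closed
  sets of the double cover.\<close>

definition cut_connected :: "'a set \<Rightarrow> 'a set set \<Rightarrow> bool" where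
  "cut_connected S E \<longleftrightarrow>
     (\<forall>T. T \<subseteq> S \<and> T \<noteq> {} \<and> (\<forall>x y. {x, y} \<in> E \<longrightarrow> x \<in> T \<longrightarrow> y \<in> T) \<longrightarrow> T = S)"

definition alt_arcs :: "'a set set \<Rightarrow> 'a set set \<Rightarrow> (('a \<times> bool) \<times> ('a \<times> bool)) set" where
  "alt_arcs R B = {((x, False), (y, True)) | x y. {x, y} \<in> R} \<union> {((x, True), (y, False)) | x y. {x, y} \<in> B}"

text \<open>A vertex set of the double cover is given by its layers \<open>P\<close> (at \<open>False\<close>) and \<open>Q\<close> (at \<open>True\<close>).
  The sets \<open>R\<close> and \<open>B\<close> need not be disjoint: an edge in both has not been decided on yet.\<close>

definition alt_closed :: "'a set set \<Rightarrow> 'a set set \<Rightarrow> 'a set \<Rightarrow> 'a set \<Rightarrow> bool" where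
  "alt_closed R B P Q \<longleftrightarrow>
     (\<forall>x y. ({x, y} \<in> R \<longrightarrow> x \<in> P \<longrightarrow> y \<in> Q) \<and> ({x, y} \<in> B \<longrightarrow> x \<in> Q \<longrightarrow> y \<in> P))"

definition alt_strong :: "'a set \<Rightarrow> 'a set set \<Rightarrow> 'a set set \<Rightarrow> bool" where
  "alt_strong S R B \<longleftrightarrow>
     (\<forall>P Q. P \<subseteq> S \<and> Q \<subseteq> S \<and> alt_closed R B P Q \<longrightarrow> P = {} \<and> Q = {} \<or> P = S \<and> Q = S)"

text \<open>No union of components of the double cover without the lifts of \<open>{u, v}\<close> separates the two
  lifts of \<open>u\<close> or those of \<open>v\<close>, that is, \<open>u\<close> and \<open>v\<close> lie on odd closed walks avoiding \<open>{u, v}\<close>.\<close>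

definition odd_linked :: "'a set \<Rightarrow> 'a set set \<Rightarrow> 'a \<Rightarrow> 'a \<Rightarrow> bool" where
  "odd_linked S E u v \<longleftrightarrow>
     (\<forall>P Q. P \<subseteq> S \<and> Q \<subseteq> S \<and> (\<forall>x y. {x, y} \<in> E - {{u, v}} \<longrightarrow> (x \<in> P \<longleftrightarrow> y \<in> Q)) \<longrightarrow>
        (u \<in> P \<longleftrightarrow> u \<in> Q) \<and> (v \<in> P \<longleftrightarrow> v \<in> Q))"

lemma odd_linkedD:
  assumes "odd_linked S E u v" "P \<subseteq> S" "Q \<subseteq> S"
    and "\<And>x y. {x, y} \<in> E \<Longrightarrow> {x, y} \<noteq> {u, v} \<Longrightarrow> x \<in> P \<longleftrightarrow> y \<in> Q"
  shows "(u \<in> P \<longleftrightarrow> u \<in> Q) \<and> (v \<in> P \<longleftrightarrow> v \<in> Q)"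
  using assms unfolding odd_linked_def by simp

lemma odd_linked_commute: "odd_linked S E u v \<longleftrightarrow> odd_linked S E v u"
  unfolding odd_linked_def by (auto simp: insert_commute)

lemma alt_closed_swap: "alt_closed R B P Q \<longleftrightarrow> alt_closed B R Q P"
  unfolding alt_closed_def by blast

lemma alt_strong_swap: "alt_strong S R B \<longleftrightarrow> alt_strong S B R"
  unfolding alt_strong_def using alt_closed_swap by blast

lemma alt_closedD1: "alt_closed R B P Q \<Longrightarrow> {x, y} \<in> R \<Longrightarrow> x \<in> P \<Longrightarrow> y \<in> Q"
  unfolding alt_closed_def by blast

lemma alt_closedD2: "alt_closed R B P Q \<Longrightarrow> {x, y} \<in> B \<Longrightarrow> x \<in> Q \<Longrightarrow> y \<in> P"
  unfolding alt_closed_def by blast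

lemma alt_closed_mono: "alt_closed R B P Q \<Longrightarrow> R' \<subseteq> R \<Longrightarrow> B' \<subseteq> B \<Longrightarrow> alt_closed R' B' P Q"
  unfolding alt_closed_def by blast

lemma alt_closed_Int:
  "alt_closed R B P Q \<Longrightarrow> alt_closed R B P' Q' \<Longrightarrow> alt_closed R B (P \<inter> P') (Q \<inter> Q')"
  unfolding alt_closed_def by blast

lemma alt_closed_Un:
  "alt_closed R B P Q \<Longrightarrow> alt_closed R B P' Q' \<Longrightarrow> alt_closed R B (P \<union> P') (Q \<union> Q')"
  unfolding alt_closed_def by blast

text \<open>The involution of the double cover reverses all arcs.\<close>

lemma alt_closed_dual:
  assumes "alt_closed R B P Q" "\<Union>(R \<union> B) \<subseteq> S"
  shows "alt_closed R B (S - Q) (S - P)"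
  unfolding alt_closed_def
proof (intro allI conjI impI)
  fix x y :: 'a
  have sym: "{x, y} = {y, x}" by blast
  { assume "{x, y} \<in> R" "x \<in> S - Q"
    then show "y \<in> S - P" using alt_closedD1[OF assms(1), of y x] assms(2) sym by auto }
  { assume "{x, y} \<in> B" "x \<in> S - P"
    then show "y \<in> S - Q" using alt_closedD2[OF assms(1), of y x] assms(2) sym by auto }
qed

section \<open>Deciding the edges by uncrossing\<close>

lemma alt_closed_insert:
  assumes "alt_closed (R - {{u, v}}) (B - {{u, v}}) P Q"
    and "u \<in> P \<longleftrightarrow> v \<in> Q" "v \<in> P \<longleftrightarrow> u \<in> Q"
  shows "alt_closed R B P Q"
  unfolding alt_closed_def
proof (intro allI conjI impI)
  fix x y
  { assume "{x, y} \<in> R" "x \<in> P"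
    then show "y \<in> Q"
      using assms alt_closedD1[OF assms(1), of x y] by (cases "{x, y} = {u, v}") (auto simp: doubleton_eq_iff) }
  { assume "{x, y} \<in> B" "x \<in> Q"
    then show "y \<in> P"
      using assms alt_closedD2[OF assms(1), of x y] by (cases "{x, y} = {u, v}") (auto simp: doubleton_eq_iff) }
qed

text \<open>The two closed sets cross the lift joining \<open>(v, False)\<close> and \<open>(u, True)\<close> in opposite directions, and
  the last two assumptions say that uncrossing them leaves no arc at the other lift; so the sets are
  complementary.\<close>

lemma no_opposite_closed:
  assumes strong: "alt_strong S R B" and sub: "\<Union>(R \<union> B) \<subseteq> S"
    and link: "odd_linked S (R \<union> B) u v" and e: "{u, v} \<in> R" "{u, v} \<in> B"
    and X: "P \<subseteq> S" "Q \<subseteq> S" "alt_closed R (B - {{u, v}}) P Q" "u \<in> Q" "v \<notin> P"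
    and Y: "P' \<subseteq> S" "Q' \<subseteq> S" "alt_closed (R - {{u, v}}) B P' Q'" "v \<in> P'" "u \<notin> Q'"
    and Int: "u \<in> P \<inter> P' \<longleftrightarrow> v \<in> Q \<inter> Q'" and Un: "u \<in> P \<union> P' \<longleftrightarrow> v \<in> Q \<union> Q'"
  shows False
proof -
  have X': "alt_closed (R - {{u, v}}) (B - {{u, v}}) P Q"
    using X(3) by (rule alt_closed_mono) auto
  have Y': "alt_closed (R - {{u, v}}) (B - {{u, v}}) P' Q'"
    using Y(3) by (rule alt_closed_mono) auto
  have "alt_closed R B (P \<inter> P') (Q \<inter> Q')"
    using alt_closed_Int[OF X' Y'] by (rule alt_closed_insert) (use Int X Y in auto)
  moreover have "P \<inter> P' \<subseteq> S" "Q \<inter> Q' \<subseteq> S" "u \<in> S" using X by auto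
  moreover have "u \<notin> Q \<inter> Q'" using Y by auto
  ultimately have disj: "P \<inter> P' = {}" "Q \<inter> Q' = {}"
    using strong unfolding alt_strong_def by blast+
  have "alt_closed R B (P \<union> P') (Q \<union> Q')"
    using alt_closed_Un[OF X' Y'] by (rule alt_closed_insert) (use Un X Y in auto)
  moreover have "P \<union> P' \<subseteq> S" "Q \<union> Q' \<subseteq> S" "u \<in> Q \<union> Q'" using X Y by auto
  ultimately have cover: "P \<union> P' = S" "Q \<union> Q' = S"
    using strong unfolding alt_strong_def by blast+
  \<comment> \<open>As the sets are complementary and both closed, no arc of another edge enters or
    leaves either of them.\<close>
  have "(u \<in> P \<longleftrightarrow> u \<in> Q) \<and> (v \<in> P \<longleftrightarrow> v \<in> Q)"
  proof (rule odd_linkedD[OF link X(1,2)])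
    fix x y assume xy: "{x, y} \<in> R \<union> B" "{x, y} \<noteq> {u, v}"
    then have S: "x \<in> S" "y \<in> S" using sub by auto
    have sym: "{x, y} = {y, x}" by blast
    from xy consider "{x, y} \<in> R - {{u, v}}" | "{x, y} \<in> B - {{u, v}}" by blast
    then show "x \<in> P \<longleftrightarrow> y \<in> Q"
    proof cases
      case 1
      then show ?thesis
        using alt_closedD1[OF X', of x y] alt_closedD1[OF Y', of x y] disj cover S by blast
    next
      case 2
      then show ?thesis
        using alt_closedD2[OF X', of y x] alt_closedD2[OF Y', of y x] sym disj cover S by (metis IntI Un_iff emptyE)
    qed
  qed
  \<comment> \<open>\<open>u\<close> is in \<open>Q\<close>, hence in \<open>P\<close>; the kept arc
    puts \<open>v\<close> in \<open>Q\<close>, hence in \<open>P\<close>.\<close>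
  then show False using X alt_closedD1[OF X(3) e(1)] by blast
qed

text \<open>The second set does not cross the other lift. If the first does not either, the two
  uncross at once; otherwise the first is replaced by a set crossing only one lift.\<close>

lemma single_cross:
  assumes strong: "alt_strong S R B" and sub: "\<Union>(R \<union> B) \<subseteq> S"
    and link: "odd_linked S (R \<union> B) u v" and e: "{u, v} \<in> R" "{u, v} \<in> B"
    and X: "P \<subseteq> S" "Q \<subseteq> S" "alt_closed R (B - {{u, v}}) P Q" "u \<in> Q" "v \<notin> P"
    and Y: "P' \<subseteq> S" "Q' \<subseteq> S" "alt_closed (R - {{u, v}}) B P' Q'" "v \<in> P'" "u \<notin> Q'"
      "u \<in> P' \<longleftrightarrow> v \<in> Q'"
  shows False
proof (cases "u \<in> P \<longleftrightarrow> v \<in> Q")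
  case True
  show False by (rule no_opposite_closed[OF strong sub link e X Y(1-5)]) (use True Y in auto)
next
  case False
  with X e alt_closedD1[OF X(3) e(1)] have F: "u \<notin> P" "v \<in> Q" by auto
  have X': "alt_closed (R - {{u, v}}) (B - {{u, v}}) P Q"
    using X(3) by (rule alt_closed_mono) auto
  have Y': "alt_closed (R - {{u, v}}) (B - {{u, v}}) P' Q'"
    using Y(3) by (rule alt_closed_mono) auto
  \<comment> \<open>Uncrossing leaves a set that crosses only the other lift; the involution moves it back.\<close>
  obtain P1 Q1 where Z: "P1 \<subseteq> S" "Q1 \<subseteq> S" "alt_closed (R - {{u, v}}) (B - {{u, v}}) P1 Q1"
    "v \<in> Q1" "u \<notin> P1" "u \<in> Q1 \<longleftrightarrow> v \<in> P1"
  proof (cases "u \<in> P'")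
    case True
    show ?thesis
      by (rule that[OF _ _ alt_closed_Int[OF X' Y']]) (use True X Y F in auto)
  next
    case False
    show ?thesis
      by (rule that[OF _ _ alt_closed_Un[OF X' Y']]) (use False X Y F in auto)
  qed
  have "alt_closed R (B - {{u, v}}) P1 Q1"
    unfolding alt_closed_def
  proof (intro allI conjI impI)
    fix x y
    { assume "{x, y} \<in> R" "x \<in> P1"
      then show "y \<in> Q1"
        using Z alt_closedD1[OF Z(3), of x y] by (cases "{x, y} = {u, v}") (auto simp: doubleton_eq_iff) }
    { assume "{x, y} \<in> B - {{u, v}}" "x \<in> Q1"
      then show "y \<in> P1" using alt_closedD2[OF Z(3), of x y] by auto }
  qed
  then have D: "alt_closed R (B - {{u, v}}) (S - Q1) (S - P1)"
    by (rule alt_closed_dual) (use sub in auto)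
  have S: "u \<in> S" "v \<in> S" using e sub by auto
  show False
    by (rule no_opposite_closed[OF strong sub link e _ _ D _ _ Y(1-5)]) (use Z Y S in auto)
qed

text \<open>If both choices fail, each gives a nontrivial set closed only thanks to the deleted
  arcs. It remains to see which of the two sets cross which lifts.\<close>

lemma alt_strong_decide_edge:
  assumes strong: "alt_strong S R B" and sub: "\<Union>(R \<union> B) \<subseteq> S"
    and link: "odd_linked S (R \<union> B) u v" and e: "{u, v} \<in> R" "{u, v} \<in> B"
  shows "alt_strong S R (B - {{u, v}}) \<or> alt_strong S (R - {{u, v}}) B"
proof (rule ccontr)
  assume "\<not> ?thesis"
  then obtain P Q P' Q' where
    X: "P \<subseteq> S" "Q \<subseteq> S" "alt_closed R (B - {{u, v}}) P Q" "\<not> (P = {} \<and> Q = {} \<or> P = S \<and> Q = S)" and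
    Y: "P' \<subseteq> S" "Q' \<subseteq> S" "alt_closed (R - {{u, v}}) B P' Q'" "\<not> (P' = {} \<and> Q' = {} \<or> P' = S \<and> Q' = S)"
    unfolding alt_strong_def by blast
  have S: "u \<in> S" "v \<in> S" using e sub by auto
  have crossX: "u \<in> Q \<and> v \<notin> P \<or> v \<in> Q \<and> u \<notin> P"
  proof (rule ccontr)
    assume n: "\<not> ?thesis"
    have "alt_closed (R - {{u, v}}) (B - {{u, v}}) P Q"
      using X(3) by (rule alt_closed_mono) auto
    then have "alt_closed R B P Q"
      by (rule alt_closed_insert)
        (use n e alt_closedD1[OF X(3), of u v] alt_closedD1[OF X(3), of v u]
          in \<open>auto simp: insert_commute\<close>)
    then show False using strong X unfolding alt_strong_def by blast
  qed
  have crossY: "u \<in> P' \<and> v \<notin> Q' \<or> v \<in> P' \<and> u \<notin> Q'"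
  proof (rule ccontr)
    assume n: "\<not> ?thesis"
    have "alt_closed (R - {{u, v}}) (B - {{u, v}}) P' Q'"
      using Y(3) by (rule alt_closed_mono) auto
    then have "alt_closed R B P' Q'"
      by (rule alt_closed_insert)
        (use n e alt_closedD2[OF Y(3), of u v] alt_closedD2[OF Y(3), of v u]
          in \<open>auto simp: insert_commute\<close>)
    then show False using strong Y unfolding alt_strong_def by blast
  qed
  \<comment> \<open>The involution exchanges the two lifts, so the crossing may be assumed at the
    one joining \<open>(v, False)\<close> and \<open>(u, True)\<close>.\<close>
  obtain P1 Q1 where
    X1: "P1 \<subseteq> S" "Q1 \<subseteq> S" "alt_closed R (B - {{u, v}}) P1 Q1" "u \<in> Q1" "v \<notin> P1"
  proof (cases "u \<in> Q \<and> v \<notin> P")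
    case True
    then show ?thesis using that X by blast
  next
    case False
    have "alt_closed R (B - {{u, v}}) (S - Q) (S - P)"
      using X(3) by (rule alt_closed_dual) (use sub in auto)
    then show ?thesis using that[of "S - Q" "S - P"] False crossX S by blast
  qed
  obtain P2 Q2 where
    Y1: "P2 \<subseteq> S" "Q2 \<subseteq> S" "alt_closed (R - {{u, v}}) B P2 Q2" "v \<in> P2" "u \<notin> Q2"
  proof (cases "v \<in> P' \<and> u \<notin> Q'")
    case True
    then show ?thesis using that Y by blast
  next
    case False
    have "alt_closed (R - {{u, v}}) B (S - Q') (S - P')"
      using Y(3) by (rule alt_closed_dual) (use sub in auto)
    then show ?thesis using that[of "S - Q'" "S - P'"] False crossY S by blast
  qed
  have vu: "{v, u} = {u, v}" by blast
  have eX: "u \<in> P1 \<Longrightarrow> v \<in> Q1" using alt_closedD1[OF X1(3) e(1)] .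
  have eY: "v \<in> Q2 \<Longrightarrow> u \<in> P2" using alt_closedD2[OF Y1(3), of v u] e(2) vu by simp
  \<comment> \<open>Each set can cross the other lift only against its kept arcs. If both cross it,
    they do so in opposite directions and uncross there too.\<close>
  consider "u \<in> P2 \<longleftrightarrow> v \<in> Q2" | "u \<in> P1 \<longleftrightarrow> v \<in> Q1" | "u \<notin> P1" "v \<in> Q1" "u \<in> P2" "v \<notin> Q2"
    using eX eY by blast
  then show False
  proof cases
    case 1
    then show False using single_cross[OF strong sub link e X1 Y1] by blast
  next
    case 2
    \<comment> \<open>Exchanging the colours exchanges the roles of the two sets.\<close>
    have sub': "\<Union>(B \<union> R) \<subseteq> S" using sub by auto
    have link': "odd_linked S (B \<union> R) v u" using link by (simp add: odd_linked_commute Un_commute)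
    have e': "{v, u} \<in> B" "{v, u} \<in> R" using e vu by auto
    have cl: "alt_closed B (R - {{v, u}}) Q2 P2" "alt_closed (B - {{v, u}}) R Q1 P1"
      using X1(3) Y1(3) alt_closed_swap vu by metis+
    show False
      using single_cross[OF strong[unfolded alt_strong_swap[of S R]] sub' link' e'
          Y1(2,1) cl(1) Y1(4,5) X1(2,1) cl(2) X1(4,5)] 2 by blast
  next
    case 3
    show False by (rule no_opposite_closed[OF strong sub link e X1 Y1]) (use 3 in auto)
  qed
qed

lemma strong_two_colouring:
  assumes "finite E" "simple_graph S E"
    and link: "\<And>u v. {u, v} \<in> E \<Longrightarrow> odd_linked S E u v"
    and start: "alt_strong S E E"
  shows "\<exists>R B. R \<union> B = E \<and> R \<inter> B = {} \<and> alt_strong S R B"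
proof -
  \<comment> \<open>\<open>R \<union> B\<close> stays equal to \<open>E\<close>, so
    \<open>link\<close> remains applicable while the number of undecided edges drops.\<close>
  have "\<exists>R B. R \<union> B = E \<and> R \<inter> B = {} \<and> alt_strong S R B"
    if "R \<union> B = E" "alt_strong S R B" for R B
    using that
  proof (induction "card (R \<inter> B)" arbitrary: R B rule: less_induct)
    case less
    show ?case
    proof (cases "R \<inter> B = {}")
      case True
      then show ?thesis using less.prems by blast
    next
      case False
      then obtain e where e: "e \<in> R" "e \<in> B" by blast
      then have "card e = 2" using less.prems assms(2) unfolding simple_graph_def by blast
      then obtain u v where uv: "e = {u, v}" by (auto simp: card_2_iff)
      have fin: "finite (R \<inter> B)" using assms(1) less.prems(1) by auto
      have sub: "\<Union>(R \<union> B) \<subseteq> S" using less.prems assms(2) unfolding simple_graph_def by blast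
      have link: "odd_linked S (R \<union> B) u v" using link less.prems(1) e uv by blast
      have smaller: "card (R \<inter> B - {e}) < card (R \<inter> B)"
        using fin e by (intro psubset_card_mono) auto
      from alt_strong_decide_edge[OF less.prems(2) sub link] e uv
      have "alt_strong S R (B - {e}) \<or> alt_strong S (R - {e}) B" by blast
      then show ?thesis
      proof
        assume "alt_strong S R (B - {e})"
        moreover have "R \<inter> (B - {e}) = R \<inter> B - {e}" by blast
        ultimately show ?thesis using less.hyps[of R "B - {e}"] smaller less.prems e by auto
      next
        assume "alt_strong S (R - {e}) B"
        moreover have "(R - {e}) \<inter> B = R \<inter> B - {e}" by blast
        ultimately show ?thesis using less.hyps[of "R - {e}" B] smaller less.prems e by auto
      qed
    qed
  qed
  from this[of E E] start show ?thesis by simp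
qed

text \<open>\<open>P \<inter> Q\<close> and \<open>P \<union> Q\<close> are closed under adjacency,
  hence trivial; a nontrivial closed set would make \<open>P\<close> one side of a
  bipartition.\<close>

lemma alt_strong_bidirected:
  assumes sub: "\<Union>E \<subseteq> S" and con: "cut_connected S E" and nb: "\<not> two_colourable E"
  shows "alt_strong S E E"
  unfolding alt_strong_def
proof (intro allI impI, elim conjE)
  fix P Q assume PQ: "P \<subseteq> S" "Q \<subseteq> S" and cl: "alt_closed E E P Q"
  have step: "x \<in> P \<Longrightarrow> y \<in> Q" "x \<in> Q \<Longrightarrow> y \<in> P" if "{x, y} \<in> E" for x y
    using alt_closedD1[OF cl that] alt_closedD2[OF cl that] by auto
  have inter: "P \<inter> Q = {} \<or> P \<inter> Q = S"
    using con[unfolded cut_connected_def, rule_format, of "P \<inter> Q"] PQ step by blast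
  have union: "P \<union> Q = {} \<or> P \<union> Q = S"
    using con[unfolded cut_connected_def, rule_format, of "P \<union> Q"] PQ step by blast
  show "P = {} \<and> Q = {} \<or> P = S \<and> Q = S"
  proof (rule ccontr)
    assume "\<not> ?thesis"
    then have dis: "P \<inter> Q = {}" "P \<union> Q = S" using inter union PQ by blast+
    have "(x \<in> P) \<noteq> (y \<in> P)" if "{x, y} \<in> E" for x y
    proof -
      have "x \<in> S" using that sub by auto
      then show ?thesis using step[OF that] dis by blast
    qed
    then show False using nb unfolding two_colourable_def by blast
  qed
qed

section \<open>A core in which all edges are odd-linked\<close>

text \<open>Absence of stubborn edges in terms of bipartitions; \<open>f\<close> need not be an
  edge, so \<open>E\<close> itself is not bipartite.\<close>

definition robust :: "'a set \<Rightarrow> 'a set set \<Rightarrow> bool" where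
  "robust S E \<longleftrightarrow> cut_connected S E \<and> (\<forall>f. \<not> two_colourable (E - {f}))"

text \<open>\<open>{w, z}\<close> is a bridge with bipartite side \<open>C\<close>. A 2-colouring of
  the rest minus \<open>f\<close> would extend over \<open>C\<close>, so cutting \<open>C\<close>
  off preserves robustness.\<close>

lemma robust_remove_bipartite_piece:
  assumes rob: "robust S E" and sub: "\<Union>E \<subseteq> S" and wz: "{w, z} \<in> E"
    and C: "C \<subseteq> S" "w \<in> C"
    and closed: "\<And>x y. {x, y} \<in> E \<Longrightarrow> {x, y} \<noteq> {w, z} \<Longrightarrow> x \<in> C \<Longrightarrow> y \<in> C"
    and bip: "\<And>x y. {x, y} \<in> E \<Longrightarrow> {x, y} \<noteq> {w, z} \<Longrightarrow> x \<in> C \<Longrightarrow> (x \<in> A) \<noteq> (y \<in> A)"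
  shows "robust (S - C) {e \<in> E. e \<subseteq> S - C}"
proof -
  have con: "cut_connected S E" and nb: "\<not> two_colourable (E - {f})" for f
    using rob unfolding robust_def by auto
  have zS: "z \<in> S" using wz sub by auto
  \<comment> \<open>Otherwise \<open>C\<close> would be all of \<open>S\<close>, and deleting
    \<open>{w, z}\<close> would leave a bipartite graph.\<close>
  have z: "z \<notin> C"
  proof
    assume z: "z \<in> C"
    have "y \<in> C" if "{x, y} \<in> E" "x \<in> C" for x y
      using closed[of x y] that z C(2) by (cases "{x, y} = {w, z}") (auto simp: doubleton_eq_iff)
    then have "C = S" using con C unfolding cut_connected_def by blast
    then have "(x \<in> A) \<noteq> (y \<in> A)" if "{x, y} \<in> E - {{w, z}}" for x y
      using bip[of x y] that sub by auto
    then show False using nb[of "{w, z}"] unfolding two_colourable_def by blast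
  qed
  have bridge: "x = w \<and> y = z" if "{x, y} \<in> E" "x \<in> C" "y \<notin> C" for x y
    using closed[of x y] that z C(2) by (auto simp: doubleton_eq_iff)
  have sub2: "x \<in> S \<and> y \<in> S" if "{x, y} \<in> E" for x y using that sub by auto
  have sym: "{y, x} \<in> E" if "{x, y} \<in> E" for x y using that by (simp add: insert_commute)
  have "cut_connected (S - C) {e \<in> E. e \<subseteq> S - C}"
    unfolding cut_connected_def
  proof (intro allI impI, elim conjE)
    fix T assume T: "T \<subseteq> S - C" "T \<noteq> {}"
      "\<forall>x y. {x, y} \<in> {e \<in> E. e \<subseteq> S - C} \<longrightarrow> x \<in> T \<longrightarrow> y \<in> T"
    then have T3: "y \<in> T" if "{x, y} \<in> E" "x \<in> T" "y \<notin> C" for x y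
      using that sub2[OF that(1)] by blast
    \<comment> \<open>\<open>C\<close> hangs at \<open>z\<close> alone, so it must be added to
      \<open>T\<close> exactly when \<open>z\<close> is in \<open>T\<close>.\<close>
    show "T = S - C"
    proof (cases "z \<in> T")
      case True
      have "y \<in> T \<union> C" if "{x, y} \<in> E" "x \<in> T \<union> C" for x y
        using T3[OF that(1)] bridge[OF that(1)] that(2) True by blast
      moreover have "T \<union> C \<subseteq> S" "T \<union> C \<noteq> {}" using T C by auto
      ultimately have "T \<union> C = S" using con unfolding cut_connected_def by blast
      then show ?thesis using T by blast
    next
      case False
      have "y \<in> T" if "{x, y} \<in> E" "x \<in> T" for x y
        using T3[OF that(1)] bridge[OF sym[OF that(1)]] that(2) False T(1) by blast
      moreover have "T \<subseteq> S" using T by auto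
      ultimately have "T = S" using con T(2) unfolding cut_connected_def by blast
      then show ?thesis using False zS by blast
    qed
  qed
  moreover have "\<not> two_colourable ({e \<in> E. e \<subseteq> S - C} - {f})" for f
  proof
    assume "two_colourable ({e \<in> E. e \<subseteq> S - C} - {f})"
    then obtain D where D: "\<And>x y. {x, y} \<in> {e \<in> E. e \<subseteq> S - C} - {f} \<Longrightarrow> (x \<in> D) \<noteq> (y \<in> D)"
      unfolding two_colourable_def by blast
    \<comment> \<open>Flip the colouring of the piece if necessary to agree with the bridge.\<close>
    define G where "G = {x. if x \<in> C then (x \<in> A) \<noteq> ((w \<in> A) = (z \<in> D)) else x \<in> D}"
    have "(x \<in> G) \<noteq> (y \<in> G)" if xy: "{x, y} \<in> E - {f}" for x y
    proof -
      have E: "{x, y} \<in> E" "{y, x} \<in> E" using xy sym by auto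
      consider "x \<in> C" "y \<in> C" | "x \<in> C" "y \<notin> C" | "x \<notin> C" "y \<in> C" | "x \<notin> C" "y \<notin> C" by blast
      then show ?thesis
      proof cases
        case 1
        then have "{x, y} \<noteq> {w, z}" using z by (auto simp: doubleton_eq_iff)
        then have "(x \<in> A) \<noteq> (y \<in> A)" using bip E 1 by blast
        then show ?thesis using 1 unfolding G_def by auto
      next
        case 2
        then have "x = w" "y = z" using bridge E by blast+
        then show ?thesis using C z unfolding G_def by auto
      next
        case 3
        then have "y = w" "x = z" using bridge E by blast+
        then show ?thesis using C z unfolding G_def by auto
      next
        case 4
        then have "(x \<in> D) \<noteq> (y \<in> D)" using D[of x y] xy sub2[OF E(1)] by blast
        then show ?thesis using 4 unfolding G_def by auto
      qed
    qed
    then show False using nb unfolding two_colourable_def by blast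
  qed
  ultimately show ?thesis unfolding robust_def by blast
qed

lemma robust_nonempty:
  assumes "robust S E" "\<Union>E \<subseteq> S"
  shows "S \<noteq> {}"
proof
  assume "S = {}"
  then have "\<forall>x y. {x, y} \<notin> E" using assms(2) by auto
  then show False using assms(1) unfolding robust_def two_colourable_def by blast
qed

lemma robust_core:
  assumes "finite V" "robust V E" "\<Union>E \<subseteq> V"
  obtains S where "S \<subseteq> V" "robust S {e \<in> E. e \<subseteq> S}"
    "\<And>u v. {u, v} \<in> E \<Longrightarrow> {u, v} \<subseteq> S \<Longrightarrow> odd_linked S {e \<in> E. e \<subseteq> S} u v"
proof -
  let ?ok = "\<lambda>S. S \<subseteq> V \<and> robust S {e \<in> E. e \<subseteq> S}"
  have "{e \<in> E. e \<subseteq> V} = E" using assms(3) by blast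
  then have V: "?ok V" using assms(2) by simp
  define S where "S = arg_min card ?ok"
  have S: "?ok S"
    unfolding S_def using V by (rule arg_min_natI)
  have min: "card S \<le> card S'" if "?ok S'" for S'
    unfolding S_def using that by (rule arg_min_nat_le)
  let ?F = "{e \<in> E. e \<subseteq> S}"
  have half: "w \<in> P \<longleftrightarrow> w \<in> Q"
    if wz: "{w, z} \<in> ?F" and PQ: "P \<subseteq> S" "Q \<subseteq> S"
      and bi: "\<forall>x y. {x, y} \<in> ?F - {{w, z}} \<longrightarrow> (x \<in> P \<longleftrightarrow> y \<in> Q)" for w z P Q
  proof (rule ccontr)
    assume w: "\<not> (w \<in> P \<longleftrightarrow> w \<in> Q)"
    \<comment> \<open>The vertices with separated lifts; apart from \<open>{w, z}\<close>, no edge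
      leaves \<open>?C\<close>, and \<open>P\<close> 2-colours the edges within it.\<close>
    let ?C = "(P - Q) \<union> (Q - P)"
    have bi': "(x \<in> P \<longleftrightarrow> y \<in> Q) \<and> (y \<in> P \<longleftrightarrow> x \<in> Q)" if "{x, y} \<in> ?F" "{x, y} \<noteq> {w, z}" for x y
    proof -
      have "{y, x} \<in> ?F - {{w, z}}" "{x, y} \<in> ?F - {{w, z}}" using that by (simp_all add: insert_commute)
      then show ?thesis using bi by blast
    qed
    have "robust (S - ?C) {e \<in> ?F. e \<subseteq> S - ?C}"
    proof (rule robust_remove_bipartite_piece[where A = P, OF _ _ wz])
      show "?C \<subseteq> S" "w \<in> ?C" using PQ w by auto
      show "y \<in> ?C" if "{x, y} \<in> ?F" "{x, y} \<noteq> {w, z}" "x \<in> ?C" for x y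
        using bi'[OF that(1,2)] that(3) by blast
      show "(x \<in> P) \<noteq> (y \<in> P)" if "{x, y} \<in> ?F" "{x, y} \<noteq> {w, z}" "x \<in> ?C" for x y
        using bi'[OF that(1,2)] that(3) by blast
    qed (use S in auto)
    moreover have "{e \<in> ?F. e \<subseteq> S - ?C} = {e \<in> E. e \<subseteq> S - ?C}" by blast
    moreover have "S - ?C \<subseteq> V" using S by blast
    ultimately have "?ok (S - ?C)" by simp
    then have "card S \<le> card (S - ?C)" by (rule min)
    moreover have "card (S - ?C) < card S"
    proof (rule psubset_card_mono)
      show "finite S" using S finite_subset[OF _ assms(1)] by blast
      have "w \<in> S" using wz by blast
      then show "S - ?C \<subset> S" using w by blast
    qed
    ultimately show False by simp
  qed
  show thesis
  proof (rule that)
    fix u v assume "{u, v} \<in> E" "{u, v} \<subseteq> S"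
    then have uv: "{u, v} \<in> ?F" "{v, u} \<in> ?F" "{v, u} = {u, v}" by (auto simp: insert_commute)
    show "odd_linked S ?F u v"
      unfolding odd_linked_def
    proof (intro allI impI, elim conjE)
      fix P Q assume PQ: "P \<subseteq> S" "Q \<subseteq> S"
        and bi: "\<forall>x y. {x, y} \<in> ?F - {{u, v}} \<longrightarrow> (x \<in> P \<longleftrightarrow> y \<in> Q)"
      show "(u \<in> P \<longleftrightarrow> u \<in> Q) \<and> (v \<in> P \<longleftrightarrow> v \<in> Q)"
        using half[OF uv(1) PQ bi] half[OF uv(2) PQ bi[folded uv(3)]] by (rule conjI)
    qed
  qed (use S in auto)
qed

section \<open>Hanging on trees and returning to coloured walks\<close>

lemma alt_arcs_mono: "R \<subseteq> R' \<Longrightarrow> B \<subseteq> B' \<Longrightarrow> alt_arcs R B \<subseteq> alt_arcs R' B'"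
  unfolding alt_arcs_def by blast

text \<open>The lifts reachable from a given one form a nonempty closed set.\<close>

lemma alt_strong_reach:
  assumes strong: "alt_strong S R B" and sub: "\<Union>(R \<union> B) \<subseteq> S" and uv: "u \<in> S" "v \<in> S"
  shows "((u, i), (v, j)) \<in> (alt_arcs R B)\<^sup>*"
proof -
  let ?reach = "\<lambda>j. {y \<in> S. ((u, i), (y, j)) \<in> (alt_arcs R B)\<^sup>*}"
  have "alt_closed R B (?reach False) (?reach True)"
    unfolding alt_closed_def
  proof (intro allI conjI impI)
    fix x y
    { assume "{x, y} \<in> R" and x: "x \<in> ?reach False"
      then have "((x, False), (y, True)) \<in> alt_arcs R B" "y \<in> S" using sub unfolding alt_arcs_def by auto
      then show "y \<in> ?reach True" using x by (auto intro: rtrancl_into_rtrancl) }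
    { assume "{x, y} \<in> B" and x: "x \<in> ?reach True"
      then have "((x, True), (y, False)) \<in> alt_arcs R B" "y \<in> S" using sub unfolding alt_arcs_def by auto
      then show "y \<in> ?reach False" using x by (auto intro: rtrancl_into_rtrancl) }
  qed
  moreover have "u \<in> ?reach i" using uv by simp
  then have "\<not> (?reach False = {} \<and> ?reach True = {})" by (cases i) auto
  ultimately have "?reach False = S \<and> ?reach True = S"
    using strong[unfolded alt_strong_def, rule_format, of "?reach False" "?reach True"] by blast
  then have "v \<in> ?reach j" using uv by (cases j) auto
  then show ?thesis by simp
qed

text \<open>Here \<open>a u\<close> is the layer in which walks starting at \<open>u\<close> are lifted.\<close>

definition alt_linked :: "'a set \<Rightarrow> 'a set set \<Rightarrow> 'a set set \<Rightarrow> ('a \<Rightarrow> bool) \<Rightarrow> bool" where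
  "alt_linked T R B a \<longleftrightarrow> (\<forall>u\<in>T. \<forall>v\<in>T. ((u, a u), (v, \<not> a v)) \<in> (alt_arcs R B)\<^sup>*)"

text \<open>Walks from \<open>y\<close> enter at \<open>(x, a x)\<close> and walks to
  \<open>y\<close> come from \<open>(x, \<not> a x)\<close>, so the old links join them, even from
  \<open>y\<close> to itself. Flipping the layer at \<open>y\<close> makes colours alternate along a
  branch.\<close>

lemma alt_linked_insert:
  assumes link: "alt_linked T R B a" and x: "x \<in> T" and y: "y \<notin> T"
    and R': "R' = (if a x then insert {x, y} R else R)"
    and B': "B' = (if a x then B else insert {x, y} B)"
  shows "alt_linked (insert y T) R' B' (a(y := \<not> a x))"
proof -
  let ?a = "a(y := \<not> a x)" and ?A = "alt_arcs R' B'"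
  have old: "((u, a u), (v, \<not> a v)) \<in> ?A\<^sup>*" if "u \<in> T" "v \<in> T" for u v
  proof -
    have "alt_arcs R B \<subseteq> ?A" using R' B' by (intro alt_arcs_mono) auto
    from rtrancl_mono[OF this] link that show ?thesis unfolding alt_linked_def by blast
  qed
  have yx: "((y, \<not> a x), (x, a x)) \<in> ?A" "((x, \<not> a x), (y, a x)) \<in> ?A"
    unfolding alt_arcs_def R' B' by (cases "a x"; auto simp: insert_commute)+
  have enter: "\<exists>t\<in>T. ((u, ?a u), (t, a t)) \<in> ?A\<^sup>*" if "u \<in> insert y T" for u
    using that y x yx(1) by (cases "u = y") auto
  have leave: "\<exists>t\<in>T. ((t, \<not> a t), (v, \<not> ?a v)) \<in> ?A\<^sup>*" if "v \<in> insert y T" for v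
    using that y x yx(2) by (cases "v = y") auto
  show ?thesis
    unfolding alt_linked_def using enter leave old by (meson rtrancl_trans)
qed

lemma alt_linked_extend:
  assumes "finite V" "simple_graph V E" and con: "cut_connected V E"
    and "T \<subseteq> V" "T \<noteq> {}" "R \<union> B \<subseteq> E" "\<Union>(R \<union> B) \<subseteq> T" "R \<inter> B = {}" "alt_linked T R B a"
  shows "\<exists>R B a. R \<union> B \<subseteq> E \<and> R \<inter> B = {} \<and> alt_linked V R B a"
  using assms(4-)
proof (induction "card (V - T)" arbitrary: T R B a rule: less_induct)
  case less
  show ?case
  proof (cases "T = V")
    case True
    then show ?thesis using less.prems by blast
  next
    case False
    then obtain x y where xy: "{x, y} \<in> E" "x \<in> T" "y \<notin> T"
      using con less.prems(1,2) unfolding cut_connected_def by blast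
    have yV: "y \<in> V" using xy assms(2) unfolding simple_graph_def by blast
    define R' where "R' = (if a x then insert {x, y} R else R)"
    define B' where "B' = (if a x then B else insert {x, y} B)"
    have new: "{x, y} \<notin> R \<union> B" using less.prems(4) xy by blast
    show ?thesis
    proof (rule less.hyps)
      show "card (V - insert y T) < card (V - T)"
        using assms(1) yV xy by (intro psubset_card_mono) auto
      show "alt_linked (insert y T) R' B' (a(y := \<not> a x))"
        using alt_linked_insert[OF less.prems(6) xy(2,3) R'_def B'_def] .
      show "R' \<inter> B' = {}" using less.prems(5) new unfolding R'_def B'_def by auto
      show "R' \<union> B' \<subseteq> E" using less.prems(3) xy unfolding R'_def B'_def by auto
      show "\<Union>(R' \<union> B') \<subseteq> insert y T" using less.prems(4) xy unfolding R'_def B'_def by auto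
    qed (use less.prems yV in auto)
  qed
qed

lemma alt_reach_properly_coloured_walk:
  assumes "((u, i), (v, j)) \<in> (alt_arcs R B)\<^sup>*"
    and "simple_graph V E" "R \<union> B \<subseteq> E" "R \<inter> B = {}" "v \<in> V"
    and c: "\<And>e. c e = (if e \<in> R then 1 else 2)"
  shows "\<exists>p. walk V E p \<and> joins p u v \<and> properly_coloured c p"
proof -
  \<comment> \<open>The layer fixes the first colour: 1 out of layer \<open>False\<close>, 2 out of
    layer \<open>True\<close>. As every arc changes the layer, prepending one keeps the walk
    properly coloured.\<close>
  have "\<exists>p. walk V E p \<and> joins p (fst s) v \<and> properly_coloured c p \<and>
      (walk_edges p \<noteq> [] \<longrightarrow> c (hd (walk_edges p)) = (if snd s then 2 else 1))"
    if "(s, (v, j)) \<in> (alt_arcs R B)\<^sup>*" for s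
    using that
  proof (induction rule: converse_rtrancl_induct)
    case base
    show ?case
      by (rule exI[of _ "[v]"]) (use assms in \<open>auto simp: walk_def joins_def properly_coloured_def\<close>)
  next
    case (step s t)
    from step.IH obtain p where p: "walk V E p" "joins p (fst t) v" "properly_coloured c p"
      "walk_edges p \<noteq> [] \<longrightarrow> c (hd (walk_edges p)) = (if snd t then 2 else 1)" by blast
    from step.hyps(1) have "{fst s, fst t} \<in> R \<and> \<not> snd s \<and> snd t \<or> {fst s, fst t} \<in> B \<and> snd s \<and> \<not> snd t"
      unfolding alt_arcs_def by auto
    then have e: "{fst s, fst t} \<in> E" "c {fst s, fst t} = (if snd s then 2 else 1)" "snd t \<longleftrightarrow> \<not> snd s"
      using assms(3,4) c by auto
    obtain q where q: "p = fst t # q"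
      using p(1,2) unfolding walk_def joins_def by (cases p) auto
    have "fst s \<in> V" using e assms(2) unfolding simple_graph_def by blast
    then have "walk V E (fst s # p)" using p(1) e unfolding walk_def q by simp
    moreover have "joins (fst s # p) (fst s) v" using p(2) unfolding joins_def q by simp
    moreover have "properly_coloured c (fst s # p)"
      using p(3,4) e unfolding properly_coloured_def q
      by (auto simp: successively_Cons)
    ultimately show ?case using e q by (intro exI[of _ "fst s # p"]) auto
  qed
  from this[OF assms(1)] show ?thesis by auto
qed

section \<open>From walks to cuts and bipartitions, and the theorem\<close>

lemma connected_graph_imp_cut_connected:
  assumes "connected_graph V E"
  shows "cut_connected V E"
  unfolding cut_connected_def
proof (intro allI impI, elim conjE)
  fix T assume T: "T \<subseteq> V" "T \<noteq> {}" and cl: "\<forall>x y. {x, y} \<in> E \<longrightarrow> x \<in> T \<longrightarrow> y \<in> T"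
  have stay: "last p \<in> T" if "p \<noteq> []" "successively (\<lambda>u v. {u, v} \<in> E) p" "hd p \<in> T" for p
    using that
  proof (induction p rule: induct_list012)
    case (3 x y zs)
    then show ?case using cl by auto
  qed auto
  obtain u where "u \<in> T" using T by blast
  show "T = V"
  proof (intro equalityI T subsetI)
    fix v assume "v \<in> V"
    then obtain p where "walk V E p" "joins p u v"
      using assms T \<open>u \<in> T\<close> unfolding connected_graph_def by blast
    then show "v \<in> T" using stay[of p] \<open>u \<in> T\<close> unfolding walk_def joins_def by auto
  qed
qed

text \<open>Every edge of a walk avoiding \<open>f\<close> changes sides, so such a closed walk has
  even length.\<close>

lemma two_colourable_imp_stubborn:
  assumes "two_colourable (E - {f})" "f \<in> E"
  shows "stubborn V E f"
proof -
  obtain A where A: "\<And>x y. {x, y} \<in> E - {f} \<Longrightarrow> (x \<in> A) \<noteq> (y \<in> A)"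
    using assms(1) unfolding two_colourable_def by blast
  have parity: "even (length (walk_edges p)) \<longleftrightarrow> (hd p \<in> A \<longleftrightarrow> last p \<in> A)"
    if "p \<noteq> []" "successively (\<lambda>u v. {u, v} \<in> E) p" "f \<notin> set (walk_edges p)" for p
    using that
  proof (induction p rule: induct_list012)
    case (3 x y zs)
    then have "(x \<in> A) \<noteq> (y \<in> A)" using A[of x y] by auto
    then show ?case using 3 by auto
  qed auto
  have "f \<in> set (walk_edges p)" if "closed_walk V E p" "odd (walk_length p)" for p
    using that parity[of p] unfolding closed_walk_def walk_def walk_length_def by auto
  then show ?thesis using assms(2) unfolding stubborn_def by blast
qed

lemma two_colourable_mono: "two_colourable E \<Longrightarrow> F \<subseteq> E \<Longrightarrow> two_colourable F"
  unfolding two_colourable_def by (meson subsetD)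

theorem theorem5:
  fixes V :: "'a set" and E :: "'a set set"
  assumes "finite V" and "simple_graph V E" and "connected_graph V E"
    and "\<not> (\<exists>e. stubborn V E e)"
  shows "\<exists>c :: 'a set \<Rightarrow> nat. c ` E \<subseteq> {1, 2} \<and> properly_connected V E c"
\<comment> \<open>Only if there is an edge does the absence of stubborn edges rule out
  bipartiteness.\<close>
proof (cases "E = {}")
  case True
  have con: "cut_connected V E" using connected_graph_imp_cut_connected assms(3) .
  have "u = v" if "u \<in> V" "v \<in> V" for u v
    using con[unfolded cut_connected_def, rule_format, of "{u}"] that True by blast
  then have "properly_connected V E c" for c
    unfolding properly_connected_def
    by (intro ballI) (rule exI[of _ "[u]" for u], auto simp: walk_def joins_def properly_coloured_def)
  then show ?thesis using True by auto
next
  case False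
  have con: "cut_connected V E" using connected_graph_imp_cut_connected assms(3) .
  have sub: "\<Union>E \<subseteq> V" using assms(2) unfolding simple_graph_def by blast
  have nb: "\<not> two_colourable (E - {f})" if "f \<in> E" for f
    using two_colourable_imp_stubborn[OF _ that] assms(4) by blast
  \<comment> \<open>For \<open>f\<close> outside \<open>E\<close>, a bipartition of \<open>E\<close>
    would serve for \<open>E\<close> minus any edge as well.\<close>
  have "\<not> two_colourable (E - {f})" for f
    using nb False two_colourable_mono[of E] by (cases "f \<in> E") auto
  then have "robust V E" using con unfolding robust_def by blast
  then obtain S where S: "S \<subseteq> V" "robust S {e \<in> E. e \<subseteq> S}"
    and linked: "\<And>u v. {u, v} \<in> E \<Longrightarrow> {u, v} \<subseteq> S \<Longrightarrow> odd_linked S {e \<in> E. e \<subseteq> S} u v"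
    using robust_core[OF assms(1) _ sub] by blast
  let ?F = "{e \<in> E. e \<subseteq> S}"
  have F: "\<Union>?F \<subseteq> S" "simple_graph S ?F" using assms(2) unfolding simple_graph_def by auto
  have "finite E" using assms(1) sub finite_subset[of E "Pow V"] by auto
  then have "finite ?F" by simp
  \<comment> \<open>Robustness at \<open>f = {}\<close> shows that \<open>?F\<close> itself is not
    bipartite.\<close>
  moreover have "alt_strong S ?F ?F"
    using alt_strong_bidirected[OF F(1)] S(2) two_colourable_mono[of ?F "?F - {{}}"]
    unfolding robust_def by blast
  ultimately obtain R B where RB: "R \<union> B = ?F" "R \<inter> B = {}" "alt_strong S R B"
    using strong_two_colouring[OF _ F(2)] linked by blast
  have RBS: "\<Union>(R \<union> B) \<subseteq> S" using RB(1) F(1) by simp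
  \<comment> \<open>Within \<open>S\<close> every lift reaches every other, so any choice of layers
    would do.\<close>
  have link: "alt_linked S R B (\<lambda>_. True)"
    unfolding alt_linked_def using alt_strong_reach[OF RB(3) RBS] by blast
  have ne: "S \<noteq> {}" using robust_nonempty S(2) F(1) .
  have RBE: "R \<union> B \<subseteq> E" using RB(1) by blast
  obtain R' B' a where ext: "R' \<union> B' \<subseteq> E" "R' \<inter> B' = {}" "alt_linked V R' B' a"
    using alt_linked_extend[OF assms(1,2) con S(1) ne RBE RBS RB(2) link] by (elim exE conjE)
  \<comment> \<open>Edges in neither set get colour 2 by default; the walks use only edges of
    \<open>R'\<close> and \<open>B'\<close>.\<close>
  define c :: "'a set \<Rightarrow> nat" where "c e = (if e \<in> R' then 1 else 2)" for e
  have "properly_connected V E c"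
    unfolding properly_connected_def
  proof (intro ballI)
    fix u v assume "u \<in> V" "v \<in> V"
    then have "((u, a u), (v, \<not> a v)) \<in> (alt_arcs R' B')\<^sup>*"
      using ext(3) unfolding alt_linked_def by blast
    then show "\<exists>p. walk V E p \<and> joins p u v \<and> properly_coloured c p"
      using alt_reach_properly_coloured_walk[OF _ assms(2) ext(1,2) \<open>v \<in> V\<close> c_def] by blast
  qed
  moreover have "c ` E \<subseteq> {1, 2}" unfolding c_def by auto
  ultimately show ?thesis by blast
qed

end
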